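(* Let $q$ be a prime power and let $C\subset \mathbb{P}^2$ be an irreducible cubic curve (that is, an irreducible plane curve of degree $3$) defined over $\mathbb{F}_q$. If $q \geq 5$, then $C$ is not blocking.
   Context: A plane curve $C=\{F=0\}\subset\mathbb{P}^2$ of degree $d$ defined over $\mathbb{F}_q$ is given by a nonzero homogeneous polynomial $F\in\mathbb{F}_q[x,y,z]$ of degree $d$; it is irreducible if $F$ is irreducible in $\mathbb{F}_q[x,y,z]$. $C(\mathbb{F}_q)$ is the set of points $[x:y:z]\in\mathbb{P}^2(\mathbb{F}_q)$ with $F(x,y,z)=0$. A set $B\subseteq\mathbb{P}^2(\mathbb{F}_q)$ is a blocking set if every line of $\mathbb{P}^2$ defined over $\mathbb{F}_q$ (an $\mathbb{F}_q$-line) contains a point of $B$. The curve $C$ is blocking (over $\mathbb{F}_q$) if $C(\mathbb{F}_q)$ is a blocking set. *)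

theory Defs
  imports
    "HOL-Library.Poly_Mapping"
    "HOL-Computational_Algebra.Factorial_Ring"
    "HOL-Number_Theory.Prime_Powers"
    "HOL-Analysis.Finite_Cartesian_Product"
begin

text \<open>The ring \<open>k[x, y, z]\<close>: the numeral type \<open>3\<close> indexes the variables, so \<open>3 \<Rightarrow>\<^sub>0 nat\<close> are the
  exponent vectors of monomials. Multiplication is convolution, and \<^const>\<open>irreducible\<close> on this
  type is irreducibility in \<open>k[x, y, z]\<close>.\<close>

type_synonym 'k ternary_poly = "(3 \<Rightarrow>\<^sub>0 nat) \<Rightarrow>\<^sub>0 'k"

definition poly_eval :: "'k::comm_semiring_1 ternary_poly \<Rightarrow> 'k ^ 3 \<Rightarrow> 'k" where
  "poly_eval F v =
     (\<Sum>m\<in>Poly_Mapping.keys F. Poly_Mapping.lookup F m * (\<Prod>i\<in>UNIV. (v $ i) ^ Poly_Mapping.lookup m i))"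

definition homogeneous :: "nat \<Rightarrow> 'k::zero ternary_poly \<Rightarrow> bool" where
  "homogeneous d F \<longleftrightarrow> (\<forall>m\<in>Poly_Mapping.keys F. (\<Sum>i\<in>UNIV. Poly_Mapping.lookup m i) = d)"

definition plane_curve :: "nat \<Rightarrow> 'k::zero ternary_poly \<Rightarrow> bool" where
  "plane_curve d F \<longleftrightarrow> F \<noteq> 0 \<and> homogeneous d F"

definition proj_rel :: "(('k::field ^ 3) \<times> ('k ^ 3)) set" where
  "proj_rel = {(u, v). u \<noteq> 0 \<and> v \<noteq> 0 \<and> (\<exists>c. c \<noteq> 0 \<and> v = c *s u)}"

definition proj_plane :: "('k::field ^ 3) set set" where
  "proj_plane = (UNIV - {0}) // proj_rel"

definition proj_point :: "'k::field ^ 3 \<Rightarrow> ('k ^ 3) set" where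
  "proj_point v = proj_rel `` {v}"

text \<open>The set of rational points of the line \<open>a\<^sub>1 x + a\<^sub>2 y + a\<^sub>3 z = 0\<close>.\<close>

definition line_points :: "'k::field ^ 3 \<Rightarrow> ('k ^ 3) set set" where
  "line_points a = {proj_point v |v. v \<noteq> 0 \<and> (\<Sum>i\<in>UNIV. a $ i * v $ i) = 0}"

text \<open>For homogeneous \<open>F\<close> the vanishing of \<open>F\<close> does not depend on the chosen representative \<open>v\<close>.\<close>

definition curve_points :: "'k::field ternary_poly \<Rightarrow> ('k ^ 3) set set" where
  "curve_points F = {proj_point v |v. v \<noteq> 0 \<and> poly_eval F v = 0}"

definition blocking_set :: "('k::field ^ 3) set set \<Rightarrow> bool" where
  "blocking_set B \<longleftrightarrow> B \<subseteq> proj_plane \<and> (\<forall>a. a \<noteq> 0 \<longrightarrow> line_points a \<inter> B \<noteq> {})"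

definition blocking_curve :: "'k::field ternary_poly \<Rightarrow> bool" where
  "blocking_curve F \<longleftrightarrow> blocking_set (curve_points F)"

end

theory Submission
  imports Defs "HOL-Computational_Algebra.Polynomial"
begin

text \<open>A line which is not a component of the cubic contains at most three of its rational points,
  because the restriction of the equation to the line is a nonzero binary cubic form. If the curve is
  blocking, then every line contains \<open>n \<in> {1, 2, 3}\<close> points, so \<open>(n - 1) (n - 3) \<le> 0\<close>. Double counting
  of incidences evaluates the sum of this product over all lines as
  \<open>N\<^sup>2 - (3 q + 4) N + 3 (q\<^sup>2 + q + 1)\<close>, where \<open>N\<close> is the number of points. The discriminant
  \<open>- 3 q\<^sup>2 + 12 q + 4\<close> is negative for \<open>q \<ge> 5\<close>, so the sum is positive. It is convenient to
  count nonzero vectors instead of projective points, which multiplies every count by \<open>q - 1\<close>.\<close>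

section \<open>Evaluation of ternary polynomials\<close>

lemma poly_mapping_eq_sum_single:
  fixes f :: "'a \<Rightarrow>\<^sub>0 'b::comm_monoid_add"
  shows "f = (\<Sum>m\<in>Poly_Mapping.keys f. Poly_Mapping.single m (Poly_Mapping.lookup f m))"
  by (rule poly_mapping_eqI) (simp add: lookup_sum lookup_single when_def in_keys_iff)

lemma poly_eval_superset:
  assumes "finite A" "Poly_Mapping.keys F \<subseteq> A"
  shows "poly_eval F v =
    (\<Sum>m\<in>A. Poly_Mapping.lookup F m * (\<Prod>i\<in>UNIV. (v $ i) ^ Poly_Mapping.lookup m i))"
  unfolding poly_eval_def using assms
  by (intro sum.mono_neutral_left) (auto simp: in_keys_iff)

lemma poly_eval_0 [simp]: "poly_eval 0 v = 0"
  by (simp add: poly_eval_def)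

lemma poly_eval_add: "poly_eval (F + G) v = poly_eval F v + poly_eval G v"
proof -
  let ?A = "Poly_Mapping.keys F \<union> Poly_Mapping.keys G"
  have "Poly_Mapping.keys (F + G) \<subseteq> ?A"
    by (rule Poly_Mapping.keys_add)
  then show ?thesis
    by (simp add: poly_eval_superset[of ?A] lookup_add distrib_right sum.distrib)
qed

lemma poly_eval_sum: "poly_eval (\<Sum>i\<in>I. F i) v = (\<Sum>i\<in>I. poly_eval (F i) v)"
  by (induction I rule: infinite_finite_induct) (simp_all add: poly_eval_add)

lemma poly_eval_single:
  "poly_eval (Poly_Mapping.single m c) v = c * (\<Prod>i\<in>UNIV. (v $ i) ^ Poly_Mapping.lookup m i)"
  by (simp add: poly_eval_superset[of "{m}"])

lemma poly_eval_1 [simp]: "poly_eval 1 v = 1"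
  by (simp add: poly_eval_single flip: single_one)

text \<open>Both factors are expanded into single terms, where convolution adds exponent vectors and
  evaluation turns this into a product of powers.\<close>

lemma poly_eval_mult: "poly_eval (F * G) v = poly_eval F v * poly_eval G v"
proof -
  have "F * G = (\<Sum>m\<in>Poly_Mapping.keys F. \<Sum>n\<in>Poly_Mapping.keys G.
      Poly_Mapping.single (m + n) (Poly_Mapping.lookup F m * Poly_Mapping.lookup G n))"
    by (subst poly_mapping_eq_sum_single[of F], subst poly_mapping_eq_sum_single[of G])
      (simp only: sum_product mult_single)
  then show ?thesis
    unfolding poly_eval_def[of F] poly_eval_def[of G]
    by (simp add: poly_eval_sum poly_eval_single sum_product lookup_add power_add prod.distrib
        algebra_simps)
qed

text \<open>Every monomial of \<open>F\<close> picks up exactly the factor \<open>c ^ d\<close>.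
  This makes the zero set of \<open>F\<close> closed under scaling, so that counting vectors instead
  of projective points is legitimate.\<close>

lemma poly_eval_scale:
  assumes "homogeneous d F"
  shows "poly_eval F (c *s v) = c ^ d * poly_eval F v"
proof -
  have "(\<Prod>i\<in>UNIV. (c * v $ i) ^ Poly_Mapping.lookup m i)
      = c ^ d * (\<Prod>i\<in>UNIV. (v $ i) ^ Poly_Mapping.lookup m i)" if "m \<in> Poly_Mapping.keys F" for m
    using assms that
    by (auto simp: homogeneous_def power_mult_distrib prod.distrib simp flip: power_sum)
  then show ?thesis
    by (simp add: poly_eval_def sum_distrib_left algebra_simps)
qed

section \<open>Restriction to a line\<close>

definition var :: "3 \<Rightarrow> 'k::comm_semiring_1 ternary_poly" where
  "var i = Poly_Mapping.single (Poly_Mapping.single i 1) 1"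

definition const :: "'k::comm_semiring_1 \<Rightarrow> 'k ternary_poly" where
  "const c = Poly_Mapping.single 0 c"

definition linear_form :: "'k::comm_semiring_1 ^ 3 \<Rightarrow> 'k ternary_poly" where
  "linear_form a = (\<Sum>i\<in>UNIV. const (a $ i) * var i)"

definition binary_form :: "3 \<Rightarrow> 3 \<Rightarrow> nat \<Rightarrow> (nat \<Rightarrow> 'k::comm_semiring_1) \<Rightarrow> 'k ternary_poly" where
  "binary_form i j d c = (\<Sum>e\<le>d. const (c e) * var i ^ e * var j ^ (d - e))"

lemma const_add: "const (a + b) = const a + const b"
  by (simp add: const_def single_add)

lemma const_mult: "const (a * b) = const a * const b"
  by (simp add: const_def mult_single)

lemma const_0 [simp]: "const 0 = 0"
  by (simp add: const_def)

lemma const_1 [simp]: "const 1 = 1"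
  by (simp add: const_def)

lemma poly_eval_const [simp]: "poly_eval (const c) v = c"
  by (simp add: const_def poly_eval_single)

lemma poly_eval_var [simp]: "poly_eval (var i) v = v $ i"
proof -
  have "(\<Prod>j\<in>UNIV. v $ j ^ Poly_Mapping.lookup (Poly_Mapping.single i 1) j) =
    (\<Prod>j\<in>UNIV. if j = i then v $ j else 1)"
    by (intro prod.cong) (auto simp: lookup_single when_def)
  then show ?thesis
    by (simp add: var_def poly_eval_single)
qed

lemma poly_eval_power: "poly_eval (F ^ n) v = poly_eval F v ^ n"
  by (induction n) (simp_all add: poly_eval_mult)

lemma poly_eval_linear_form [simp]: "poly_eval (linear_form a) v = (\<Sum>i\<in>UNIV. a $ i * v $ i)"
  by (simp add: linear_form_def poly_eval_sum poly_eval_mult)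

lemma poly_eval_binary_form:
  "poly_eval (binary_form i j d c) v = (\<Sum>e\<le>d. c e * (v $ i) ^ e * (v $ j) ^ (d - e))"
  by (simp add: binary_form_def poly_eval_sum poly_eval_mult poly_eval_power)

lemma binary_form_add: "binary_form i j d b + binary_form i j d c = binary_form i j d (\<lambda>e. b e + c e)"
  by (simp add: binary_form_def const_add sum.distrib distrib_right)

lemma binary_form_const: "const b * binary_form i j d c = binary_form i j d (\<lambda>e. b * c e)"
  by (simp add: binary_form_def const_mult sum_distrib_left mult.assoc)

lemma binary_form_var_left:
  "var i * binary_form i j d c = binary_form i j (Suc d) (\<lambda>e. case e of 0 \<Rightarrow> 0 | Suc e \<Rightarrow> c e)"
  by (simp add: binary_form_def sum.atMost_Suc_shift sum_distrib_left algebra_simps del: sum.atMost_Suc)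

text \<open>The powers of \<open>var i\<close> do not change, so the coefficients stay in place. The
  new top coefficient, at \<open>Suc d\<close>, must be reset to 0 because \<open>c\<close> is
  arbitrary beyond \<open>d\<close>.\<close>

lemma binary_form_var_right:
  "var j * binary_form i j d c = binary_form i j (Suc d) (\<lambda>e. if e \<le> d then c e else 0)"
  by (simp add: binary_form_def sum_distrib_left Suc_diff_le algebra_simps)

section \<open>Reduction of homogeneous polynomials to binary forms modulo a linear form\<close>

context
  fixes a :: "'k::field ^ 3" and i j k :: 3
  assumes UNIV_eq: "UNIV = {i, j, k}" and distinct: "i \<noteq> j" "i \<noteq> k" "j \<noteq> k" and a_k: "a $ k \<noteq> 0"
begin

text \<open>On the line \<open>a \<bullet> v = 0\<close> the coordinate \<open>v\<^sub>k\<close> is a combination of \<open>v\<^sub>i\<close> and \<open>v\<^sub>j\<close>, so modulo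
  the linear form every homogeneous polynomial is a binary form in the other two variables.\<close>

definition reducible_to_binary :: "nat \<Rightarrow> 'k ternary_poly \<Rightarrow> bool" where
  "reducible_to_binary d P \<longleftrightarrow> (\<exists>c H. P = binary_form i j d c + linear_form a * H)"

lemma reducible_to_binary_add:
  assumes "reducible_to_binary d P" "reducible_to_binary d Q"
  shows "reducible_to_binary d (P + Q)"
proof -
  obtain c H c' H' where "P = binary_form i j d c + linear_form a * H"
    "Q = binary_form i j d c' + linear_form a * H'"
    using assms by (auto simp: reducible_to_binary_def)
  then have "P + Q = binary_form i j d (\<lambda>e. c e + c' e) + linear_form a * (H + H')"
    by (simp add: binary_form_add[symmetric] algebra_simps)
  then show ?thesis
    by (auto simp: reducible_to_binary_def)
qed

lemma reducible_to_binary_const: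
  assumes "reducible_to_binary d P"
  shows "reducible_to_binary d (const b * P)"
proof -
  obtain c H where "P = binary_form i j d c + linear_form a * H"
    using assms by (auto simp: reducible_to_binary_def)
  then have "const b * P = binary_form i j d (\<lambda>e. b * c e) + linear_form a * (const b * H)"
    by (simp add: binary_form_const[symmetric] algebra_simps)
  then show ?thesis
    by (auto simp: reducible_to_binary_def)
qed

text \<open>Multiplication by \<open>var i\<close> or \<open>var j\<close> acts on the coefficients
  of the binary form. For \<open>var k\<close>, the linear form is solved for \<open>var k\<close>,
  which is possible since \<open>a $ k\<close> is invertible.\<close>

lemma reducible_to_binary_var:
  assumes "reducible_to_binary d P"
  shows "reducible_to_binary (Suc d) (var l * P)"
proof -
  obtain c H where P: "P = binary_form i j d c + linear_form a * H"
    using assms by (auto simp: reducible_to_binary_def)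
  have left: "reducible_to_binary (Suc d) (var i * P)"
    unfolding P reducible_to_binary_def distrib_left binary_form_var_left
    \<comment> \<open>Unification finds both witnesses: \<open>refl\<close> the shifted
      coefficients, \<open>mult.left_commute\<close> the cofactor \<open>var i * H\<close>.\<close>
    by (intro exI) (rule arg_cong2[where f = "(+)", OF refl mult.left_commute])
  have right: "reducible_to_binary (Suc d) (var j * P)"
    unfolding P reducible_to_binary_def distrib_left binary_form_var_right
    by (intro exI) (rule arg_cong2[where f = "(+)", OF refl mult.left_commute])
  have zero: "reducible_to_binary (Suc d) (linear_form a * Q)" for Q
    unfolding reducible_to_binary_def
    by (rule exI[of _ "\<lambda>_. 0"]) (auto simp: binary_form_def)
  have *: "const (inverse (a $ k)) * const (a $ k) = 1"
    using a_k by (simp flip: const_mult)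
  have "linear_form a = const (a $ i) * var i + const (a $ j) * var j + const (a $ k) * var k"
    using distinct by (simp add: linear_form_def UNIV_eq)
  \<comment> \<open>The left side combines polynomials already known to be reducible in degree
    \<open>Suc d\<close>. On the right, the contributions of \<open>var i\<close> and
    \<open>var j\<close> are gathered under \<open>const (1 + -1)\<close>, which vanishes.\<close>
  then have "const (inverse (a $ k)) * (linear_form a * P + const (-1) * (const (a $ i) * (var i * P))
      + const (-1) * (const (a $ j) * (var j * P)))
    = (const (inverse (a $ k)) * const (a $ k)) * (var k * P)
    + const (inverse (a $ k)) * (const (1 + -1) * (const (a $ i) * (var i * P)
      + const (a $ j) * (var j * P)))"
    by (simp only: const_add const_1 mult_1_left algebra_simps)
  also have "\<dots> = var k * P"
    by (simp add: *)
  finally have "reducible_to_binary (Suc d) (var k * P)"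
    using left right zero
    by (metis reducible_to_binary_add reducible_to_binary_const)
  then show ?thesis
    using left right UNIV_eq by (metis UNIV_I insert_iff singletonD)
qed

text \<open>Induction on the total degree, splitting off one variable that occurs in the
  monomial.\<close>

lemma reducible_to_binary_monomial:
  "reducible_to_binary (\<Sum>l\<in>UNIV. Poly_Mapping.lookup m l) (Poly_Mapping.single m 1)"
proof (induction "\<Sum>l\<in>UNIV. Poly_Mapping.lookup m l" arbitrary: m)
  case 0
  then have "m = 0"
    by (intro poly_mapping_eqI) simp
  moreover have "1 = binary_form i j 0 (\<lambda>_. 1) + linear_form a * 0"
    by (simp add: binary_form_def)
  ultimately show ?case
    unfolding reducible_to_binary_def by (metis "0" single_one)
next
  case (Suc d)
  then obtain l where l: "Poly_Mapping.lookup m l \<noteq> 0"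
    by (metis Zero_not_Suc sum.neutral)
  \<comment> \<open>The subtraction of exponents is truncated, but it is exact here because
    \<open>l\<close> has a nonzero exponent in \<open>m\<close>.\<close>
  define m' where "m' = m - Poly_Mapping.single l 1"
  have m: "m = Poly_Mapping.single l 1 + m'"
    using l by (intro poly_mapping_eqI)
      (auto simp: m'_def lookup_add lookup_minus lookup_single when_def)
  have "(\<Sum>x\<in>UNIV. Poly_Mapping.lookup (Poly_Mapping.single l (1::nat)) x) = 1"
    by (simp add: lookup_single when_def)
  then have "Suc d = Suc (\<Sum>x\<in>UNIV. Poly_Mapping.lookup m' x)"
    using Suc.hyps(2) by (simp add: m lookup_add sum.distrib)
  then have d: "d = (\<Sum>x\<in>UNIV. Poly_Mapping.lookup m' x)"
    by simp
  have "reducible_to_binary (Suc d) (var l * Poly_Mapping.single m' 1)"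
    using Suc.hyps(1)[OF d] by (intro reducible_to_binary_var) (simp flip: d)
  then show ?case
    unfolding Suc.hyps(2)[symmetric] var_def mult_single m[symmetric] by simp
qed

lemma reducible_to_binary_homogeneous:
  assumes "homogeneous d F"
  shows "reducible_to_binary d F"
proof -
  have "reducible_to_binary d (const (Poly_Mapping.lookup F m) * Poly_Mapping.single m 1)"
    if "m \<in> Poly_Mapping.keys F" for m
    using assms that reducible_to_binary_monomial[of m]
    by (intro reducible_to_binary_const) (simp add: homogeneous_def)
  then have "reducible_to_binary d (Poly_Mapping.single m (Poly_Mapping.lookup F m))"
    if "m \<in> Poly_Mapping.keys F" for m
    using that by (simp add: const_def mult_single)
  moreover have "reducible_to_binary d (\<Sum>m\<in>A. Poly_Mapping.single m (Poly_Mapping.lookup F m))"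
    if "\<And>m. m \<in> A \<Longrightarrow> reducible_to_binary d (Poly_Mapping.single m (Poly_Mapping.lookup F m))" for A
    using that
  proof (induction A rule: infinite_finite_induct)
    case (insert m A)
    then show ?case
      by (simp add: reducible_to_binary_add)
  qed (auto simp: reducible_to_binary_def binary_form_def intro!: exI[of _ "\<lambda>_. 0"] exI[of _ 0])
  ultimately show ?thesis
    by (metis poly_mapping_eq_sum_single)
qed

end

section \<open>Zeros of a form on a line\<close>

text \<open>Zeros with \<open>t \<noteq> 0\<close> correspond to a root \<open>s / t\<close> of the
  dehomogenized polynomial together with a free choice of \<open>t\<close>. The point at infinity
  \<open>t = 0\<close> is a zero only if \<open>c d = 0\<close>, and then the degree of that
  polynomial drops below \<open>d\<close>, which makes room for it.\<close>

lemma card_zeros_binary_form: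
  fixes c :: "nat \<Rightarrow> 'k::{field,finite}"
  assumes "e \<le> d" "c e \<noteq> 0"
  shows "card {(s, t). (s, t) \<noteq> (0, 0) \<and> (\<Sum>e\<le>d. c e * s ^ e * t ^ (d - e)) = 0}
    \<le> d * (CARD('k) - 1)" (is "card ?Z \<le> _")
proof -
  define p where "p = (\<Sum>e\<le>d. monom (c e) e)"
  have coeff_p: "coeff p e = (if e \<le> d then c e else 0)" for e
    by (simp add: p_def coeff_sum if_distrib cong: if_cong)
  then have "p \<noteq> 0"
    using assms by (metis coeff_0)
  define R where "R = {x. poly p x = 0}"
  have R: "card R \<le> degree p"
    unfolding R_def by (rule card_poly_roots_bound) fact
  \<comment> \<open>\<open>T\<close> collects the nonzero vectors at infinity: setting
    \<open>t = 0\<close> leaves only the term \<open>c d * s ^ d\<close>.\<close>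
  define T where "T = (if c d = 0 then (UNIV - {0::'k}) \<times> {0::'k} else {})"
  have "?Z \<subseteq> (\<lambda>(r, t). (r * t, t)) ` (R \<times> (UNIV - {0})) \<union> T"
  proof (rule subsetI, rule ccontr)
    fix x assume "x \<in> ?Z" and notin: "x \<notin> (\<lambda>(r, t). (r * t, t)) ` (R \<times> (UNIV - {0})) \<union> T"
    then obtain s t where x: "x = (s, t)" and st: "(s, t) \<noteq> (0, 0)"
      and zero: "(\<Sum>e\<le>d. c e * s ^ e * t ^ (d - e)) = 0"
      by blast
    have "t \<noteq> 0"
    proof
      assume [simp]: "t = 0"
      have "(\<Sum>e\<le>d. c e * s ^ e * t ^ (d - e)) = (\<Sum>e\<le>d. if e = d then c e * s ^ e else 0)"
        by (intro sum.cong) auto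
      then have "c d * s ^ d = 0"
        using zero by simp
      then show False
        using st notin by (auto simp: x T_def split: if_splits)
    qed
    have "t ^ d * poly p (s / t) = (\<Sum>e\<le>d. c e * s ^ e * t ^ (d - e))"
      using \<open>t \<noteq> 0\<close>
      by (simp add: p_def poly_sum poly_monom sum_distrib_left power_divide power_diff mult_ac)
    then have "s / t \<in> R"
      using zero \<open>t \<noteq> 0\<close> by (simp add: R_def)
    then have "(s, t) \<in> (\<lambda>(r, t). (r * t, t)) ` (R \<times> (UNIV - {0}))"
      using \<open>t \<noteq> 0\<close> by (intro image_eqI[of _ _ "(s / t, t)"]) auto
    then show False
      using notin by (simp add: x)
  qed
  then have "card ?Z \<le> card ((\<lambda>(r, t). (r * t, t)) ` (R \<times> (UNIV - {0})) \<union> T)"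
    by (intro card_mono) auto
  also have "\<dots> \<le> card (R \<times> (UNIV - {0::'k})) + card T"
    by (rule order_trans[OF card_Un_le add_mono[OF card_image_le order_refl]]) simp
  also have "\<dots> = (card R + (if c d = 0 then 1 else 0)) * (CARD('k) - 1)"
    by (simp add: T_def card_Diff_singleton distrib_right del: One_nat_def)
  also have "card R + (if c d = 0 then 1 else 0) \<le> d"
  proof (cases "c d = 0")
    case True
    \<comment> \<open>The nonzero coefficient at \<open>e\<close> forces \<open>d\<close> to be
      positive, so that a degree strictly below \<open>d\<close> is possible.\<close>
    then have "e < d"
      using assms by (cases "e = d") auto
    moreover have "degree p < d"
      by (rule degree_lessI) (use \<open>e < d\<close> True in \<open>auto simp: coeff_p\<close>)
    ultimately show ?thesis
      using R True by simp
  next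
    case False
    have "degree p \<le> d"
      by (rule degree_le) (simp add: coeff_p)
    then show ?thesis
      using R False by simp
  qed
  finally show ?thesis
    by simp
qed

text \<open>In a factorization of \<open>F\<close> by the linear form one factor would be a unit.
  The linear form vanishes at the origin and so is not one; if the cofactor is a unit, then
  \<open>F\<close> divides a form of degree 1, contradicting \<open>2 \<le> d\<close>.\<close>

lemma linear_form_not_dvd_irreducible:
  fixes F :: "'k::field ternary_poly"
  assumes "homogeneous d F" "irreducible F" "2 \<le> d" "a \<noteq> 0"
  shows "\<not> linear_form a dvd F"
proof
  assume "linear_form a dvd F"
  then obtain H where F: "F = linear_form a * H"
    by (rule dvdE)
  consider "linear_form a dvd 1" | "H dvd 1"
    using assms(2) F unfolding irreducible_def by blast
  then show False
  proof cases
    case 1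
    then obtain G where G: "linear_form a * G = 1"
      by (metis dvdE)
    have "poly_eval (linear_form a * G) 0 = 1"
      by (simp only: G poly_eval_1)
    then show False
      by (simp add: poly_eval_mult)
  next
    case 2
    then obtain G where "1 = H * G"
      by (rule dvdE)
    then have FG: "linear_form a = F * G"
      by (simp add: F mult.assoc)
    obtain k where k: "a $ k \<noteq> 0"
      using assms(4) by (auto simp: vec_eq_iff)
    have [simp]: "Poly_Mapping.single i (Suc 0) = Poly_Mapping.single k (Suc 0) \<longleftrightarrow> i = k" for i :: 3
      by (metis keys_single nat.distinct(1) singleton_inject)
    have "Poly_Mapping.lookup (linear_form a) (Poly_Mapping.single k 1) =
      (\<Sum>i\<in>UNIV. if i = k then a $ i else 0)"
      by (auto simp: linear_form_def lookup_sum const_def var_def mult_single lookup_single when_def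
          intro!: sum.cong)
    \<comment> \<open>A monomial of \<open>F * G\<close> is a product of monomials of
      \<open>F\<close> and \<open>G\<close>, so its degree is at least \<open>d\<close>; the
      monomial \<open>var k\<close> occurs but has degree 1.\<close>
    then have "Poly_Mapping.single k 1 \<in> Poly_Mapping.keys (F * G)"
      using k by (simp add: in_keys_iff flip: FG)
    then obtain m n where m: "m \<in> Poly_Mapping.keys F" and n: "Poly_Mapping.single k (1::nat) = m + n"
      using Poly_Mapping.keys_mult[of F G] by blast
    have "(\<Sum>i\<in>UNIV. Poly_Mapping.lookup m i) = d"
      using assms(1) m by (simp add: homogeneous_def)
    moreover have "(\<Sum>i\<in>UNIV. Poly_Mapping.lookup (Poly_Mapping.single k (1::nat)) i) = 1"
      by (simp add: lookup_single when_def)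
    ultimately show False
      using assms(3) unfolding n lookup_add sum.distrib by simp
  qed
qed

text \<open>Projection to the coordinates \<open>i\<close> and \<open>j\<close> is injective on the
  plane orthogonal to \<open>a\<close> and maps zeros of \<open>F\<close> to zeros of a binary form.
  That form is nonzero, since otherwise the linear form would divide \<open>F\<close>.\<close>

lemma card_zeros_on_line:
  fixes F :: "'k::{field,finite} ternary_poly"
  assumes "homogeneous d F" "irreducible F" "2 \<le> d" "a \<noteq> 0"
  shows "card {v. v \<noteq> 0 \<and> poly_eval F v = 0 \<and> (\<Sum>i\<in>UNIV. a $ i * v $ i) = 0} \<le> d * (CARD('k) - 1)"
    (is "card ?Z \<le> _")
proof -
  obtain k where k: "a $ k \<noteq> 0"
    using assms(4) by (auto simp: vec_eq_iff)
  have "card (UNIV - {k}) = 2"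
    by (simp add: card_Diff_singleton)
  then obtain i j where ij: "UNIV - {k} = {i, j}" "i \<noteq> j"
    by (meson card_2_iff)
  then have UNIV_eq: "UNIV = {i, j, k}" and distinct: "i \<noteq> j" "i \<noteq> k" "j \<noteq> k"
    by auto
  obtain c H where F: "F = binary_form i j d c + linear_form a * H"
    using reducible_to_binary_homogeneous[OF UNIV_eq distinct k assms(1)]
    unfolding reducible_to_binary_def[OF UNIV_eq distinct k] by blast
  have "\<exists>e\<le>d. c e \<noteq> 0"
  proof (rule ccontr)
    assume "\<not> ?thesis"
    then have "F = linear_form a * H"
      by (simp add: F binary_form_def)
    then show False
      using linear_form_not_dvd_irreducible[OF assms] by simp
  qed
  then obtain e where e: "e \<le> d" "c e \<noteq> 0"
    by blast
  have inj: "v = w" if "(\<Sum>i\<in>UNIV. a $ i * v $ i) = 0" "(\<Sum>i\<in>UNIV. a $ i * w $ i) = 0"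
    "v $ i = w $ i" "v $ j = w $ j" for v w
  proof -
    have dot: "(\<Sum>l\<in>UNIV. a $ l * x $ l) = a $ i * x $ i + a $ j * x $ j + a $ k * x $ k" for x
      using distinct by (simp add: UNIV_eq)
    have "a $ k * v $ k = a $ k * w $ k"
      using that(1,2) unfolding dot that(3,4) by (metis add_left_cancel)
    then have "v $ k = w $ k"
      using k by simp
    then have "v $ l = w $ l" for l
      using that(3,4) UNIV_I[of l] unfolding UNIV_eq by blast
    then show ?thesis
      by (simp add: vec_eq_iff)
  qed
  have "card ?Z = card ((\<lambda>v. (v $ i, v $ j)) ` ?Z)"
    by (intro card_image[symmetric] inj_onI) (use inj in blast)
  also have "\<dots> \<le> card {(s, t). (s, t) \<noteq> (0, 0) \<and> (\<Sum>e\<le>d. c e * s ^ e * t ^ (d - e)) = 0}"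
  proof (intro card_mono image_subsetI; clarsimp)
    fix v assume v: "v \<noteq> 0" "poly_eval F v = 0" "(\<Sum>i\<in>UNIV. a $ i * v $ i) = 0"
    have "(\<Sum>e\<le>d. c e * v $ i ^ e * v $ j ^ (d - e)) = 0"
      using v by (simp add: F poly_eval_add poly_eval_mult poly_eval_binary_form)
    then show "(v $ i = 0 \<longrightarrow> v $ j \<noteq> 0) \<and> (\<Sum>e\<le>d. c e * v $ i ^ e * v $ j ^ (d - e)) = 0"
      \<comment> \<open>Comparison with the zero vector shows that a nonzero \<open>v\<close> does
        not project to \<open>(0, 0)\<close>.\<close>
      using v inj[of v 0] by auto
  qed
  also have "\<dots> \<le> d * (CARD('k) - 1)"
    using e by (rule card_zeros_binary_form)
  finally show ?thesis .
qed

section \<open>Double counting of incidences\<close>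

text \<open>\<open>W\<close> is the direct sum of the span of \<open>w\<close> and the kernel of
  \<open>f\<close> on \<open>W\<close>: the component of \<open>x\<close> along \<open>w\<close> has
  coefficient \<open>f x / f w\<close>.\<close>

lemma card_eq_card_kernel:
  fixes W :: "('k::{field,finite} ^ 'n) set" and f :: "'k ^ 'n \<Rightarrow> 'k"
  assumes W_add: "\<And>x y. x \<in> W \<Longrightarrow> y \<in> W \<Longrightarrow> x + y \<in> W"
    and W_scale: "\<And>c x. x \<in> W \<Longrightarrow> c *s x \<in> W"
    and f_add: "\<And>x y. f (x + y) = f x + f y" and f_scale: "\<And>c x. f (c *s x) = c * f x"
    and w: "w \<in> W" "f w \<noteq> 0"
  shows "card W = CARD('k) * card {x \<in> W. f x = 0}"
proof -
  let ?K = "{x \<in> W. f x = 0}"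
  have "bij_betw (\<lambda>(c, x). c *s w + x) (UNIV \<times> ?K) W"
  proof (rule bij_betw_byWitness[where f' = "\<lambda>x. (f x / f w, x + (- (f x / f w)) *s w)"])
    show "(\<lambda>x. (f x / f w, x + (- (f x / f w)) *s w)) ` W \<subseteq> UNIV \<times> ?K"
    proof (rule image_subsetI)
      fix x assume "x \<in> W"
      then show "(f x / f w, x + (- (f x / f w)) *s w) \<in> UNIV \<times> ?K"
        using w W_add[OF _ W_scale, of x w] by (simp only: mem_Times_iff mem_Collect_eq fst_conv snd_conv f_add f_scale) simp
    qed
  qed (use w in \<open>auto simp: f_add f_scale vec_eq_iff intro: W_add W_scale\<close>)
  then have "card (UNIV \<times> ?K :: ('k \<times> _) set) = card W"
    by (rule bij_betw_same_card)
  then show ?thesis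
    by (simp add: card_cartesian_product)
qed

lemma dot_add: "(\<Sum>i\<in>UNIV. (x + y) $ i * u $ i) = (\<Sum>i\<in>UNIV. x $ i * u $ i) + (\<Sum>i\<in>UNIV. y $ i * u $ i)"
  for u :: "'k::comm_semiring_1 ^ 'n"
  by (simp add: distrib_right sum.distrib)

lemma dot_scale: "(\<Sum>i\<in>UNIV. (c *s x) $ i * u $ i) = c * (\<Sum>i\<in>UNIV. x $ i * u $ i)"
  for u :: "'k::comm_semiring_1 ^ 'n"
  by (simp add: sum_distrib_left mult.assoc)

lemma dot_axis: "(\<Sum>i\<in>UNIV. axis j c $ i * u $ i) = c * u $ j"
  for u :: "'k::comm_semiring_1 ^ 'n"
proof -
  have "(\<Sum>i\<in>UNIV. axis j c $ i * u $ i) = (\<Sum>i\<in>UNIV. if i = j then c * u $ i else 0)"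
    by (intro sum.cong) (auto simp: axis_def)
  then show ?thesis
    by simp
qed

lemma card_hyperplane:
  fixes u :: "'k::{field,finite} ^ 'n"
  assumes "u \<noteq> 0"
  shows "CARD('k) ^ CARD('n) = CARD('k) * card {a. (\<Sum>i\<in>UNIV. a $ i * u $ i) = 0}"
proof -
  obtain k where "u $ k \<noteq> 0"
    using assms by (auto simp: vec_eq_iff)
  then have "card (UNIV :: ('k ^ 'n) set) = CARD('k) * card {a \<in> UNIV. (\<Sum>i\<in>UNIV. a $ i * u $ i) = 0}"
    by (intro card_eq_card_kernel[where w = "axis k 1"]) (simp_all add: dot_add dot_scale dot_axis del: vector_add_component vector_smult_component)
  then show ?thesis
    by (simp add: CARD_vec)
qed

text \<open>The kernel count is applied twice. Since \<open>v\<close> is not a multiple of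
  \<open>u\<close>, the functional given by \<open>v\<close> does not vanish on the hyperplane given
  by \<open>u\<close>.\<close>

lemma card_codim2:
  fixes u v :: "'k::{field,finite} ^ 'n"
  assumes "u \<noteq> 0" "\<And>c. v \<noteq> c *s u"
  shows "CARD('k) ^ CARD('n) =
    CARD('k)\<^sup>2 * card {a. (\<Sum>i\<in>UNIV. a $ i * u $ i) = 0 \<and> (\<Sum>i\<in>UNIV. a $ i * v $ i) = 0}"
proof -
  let ?W = "{a. (\<Sum>i\<in>UNIV. a $ i * u $ i) = 0}"
  obtain k where k: "u $ k \<noteq> 0"
    using assms by (auto simp: vec_eq_iff)
  obtain j where j: "v $ j \<noteq> v $ k / u $ k * u $ j"
    using assms(2)[of "v $ k / u $ k"] by (auto simp: vec_eq_iff)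
  \<comment> \<open>This \<open>w\<close> is orthogonal to \<open>u\<close>, and its product with
    \<open>v\<close> is the minor \<open>u $ k * v $ j - u $ j * v $ k\<close>, nonzero by the
    choice of \<open>j\<close>.\<close>
  define w where "w = axis j (u $ k) + axis k (- u $ j)"
  have "w \<in> ?W" "(\<Sum>i\<in>UNIV. w $ i * v $ i) \<noteq> 0"
    using j k unfolding w_def mem_Collect_eq dot_add dot_axis by (simp_all add: field_simps)
  then have "card ?W = CARD('k) * card {a \<in> ?W. (\<Sum>i\<in>UNIV. a $ i * v $ i) = 0}"
    by (intro card_eq_card_kernel[where w = w])
      (simp_all add: dot_add dot_scale del: vector_add_component vector_smult_component)
  then show ?thesis
    using card_hyperplane[OF assms(1)] by (simp add: power2_eq_square)
qed

lemma int_card_remove: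
  assumes "finite A" "x \<in> A"
  shows "int (card (A - {x})) = int (card A) - 1"
  by (simp only: card.remove[OF assms] of_nat_Suc add_diff_cancel_left')

lemma card_nonzero_orthogonal:
  fixes u :: "'k::{field,finite} ^ 3"
  assumes "u \<noteq> 0"
  shows "int (card {a \<in> UNIV - {0}. (\<Sum>i\<in>UNIV. a $ i * u $ i) = 0}) = (int CARD('k))\<^sup>2 - 1"
proof -
  let ?A = "{a. (\<Sum>i\<in>UNIV. a $ i * u $ i) = 0}"
  have "int CARD('k) ^ 3 = int CARD('k) * int (card ?A)"
    using card_hyperplane[OF assms] by (simp flip: of_nat_mult of_nat_power)
  then have "int (card ?A) = (int CARD('k))\<^sup>2"
    by (simp add: power3_eq_cube power2_eq_square)
  moreover have "{a \<in> UNIV - {0}. (\<Sum>i\<in>UNIV. a $ i * u $ i) = 0} = ?A - {0}"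
    by auto
  moreover have "int (card (?A - {0})) = int (card ?A) - 1"
    by (rule int_card_remove) simp_all
  ultimately show ?thesis
    by (simp only:)
qed

lemma card_nonzero_orthogonal2:
  fixes u v :: "'k::{field,finite} ^ 3"
  assumes "u \<noteq> 0" "\<And>c. v \<noteq> c *s u"
  shows "int (card {a \<in> UNIV - {0}. (\<Sum>i\<in>UNIV. a $ i * u $ i) = 0 \<and> (\<Sum>i\<in>UNIV. a $ i * v $ i) = 0})
    = int CARD('k) - 1"
proof -
  let ?A = "{a. (\<Sum>i\<in>UNIV. a $ i * u $ i) = 0 \<and> (\<Sum>i\<in>UNIV. a $ i * v $ i) = 0}"
  have "int CARD('k) ^ 3 = (int CARD('k))\<^sup>2 * int (card ?A)"
    using card_codim2[OF assms] by (simp flip: of_nat_mult of_nat_power)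
  then have "int (card ?A) = int CARD('k)"
    by (simp add: power3_eq_cube power2_eq_square)
  moreover have "{a \<in> UNIV - {0}. (\<Sum>i\<in>UNIV. a $ i * u $ i) = 0 \<and> (\<Sum>i\<in>UNIV. a $ i * v $ i) = 0} = ?A - {0}"
    by auto
  moreover have "int (card (?A - {0})) = int (card ?A) - 1"
    by (rule int_card_remove) simp_all
  ultimately show ?thesis
    by (simp only:)
qed

text \<open>This is the number of vectors representing one projective point, the factor by which
  vector counts exceed point counts.\<close>

lemma card_multiples:
  fixes u :: "'k::{field,finite} ^ 'n"
  assumes "u \<noteq> 0"
  shows "card ((\<lambda>c. c *s u) ` (UNIV - {0::'k})) = CARD('k) - 1"
proof -
  obtain k where "u $ k \<noteq> 0"
    using assms by (auto simp: vec_eq_iff)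
  then have "inj_on (\<lambda>c. c *s u) (UNIV - {0})"
    by (intro inj_onI) (metis mult_cancel_right vector_smult_component)
  then show ?thesis
    by (simp add: card_image card_Diff_singleton)
qed

section \<open>First and second moments of the line intersections of a punctured cone\<close>

context
  fixes Z :: "('k::{field,finite} ^ 3) set"
  assumes nonzero: "0 \<notin> Z" and scale: "\<And>c v. v \<in> Z \<Longrightarrow> c \<noteq> 0 \<Longrightarrow> c *s v \<in> Z"
begin

text \<open>Swapping the order of summation counts, for each \<open>v\<close>, the nonzero
  \<open>a\<close> orthogonal to it. Lines are also counted by vectors, each one
  \<open>CARD('k) - 1\<close> times.\<close>

lemma sum_incidences:
  "(\<Sum>a\<in>UNIV - {0}. int (card {v \<in> Z. (\<Sum>i\<in>UNIV. a $ i * v $ i) = 0}))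
    = int (card Z) * ((int CARD('k))\<^sup>2 - 1)"
proof -
  have "(\<Sum>a\<in>UNIV - {0}. int (card {v \<in> Z. (\<Sum>i\<in>UNIV. a $ i * v $ i) = 0}))
    = (\<Sum>a\<in>UNIV - {0}. \<Sum>v\<in>Z. of_bool ((\<Sum>i\<in>UNIV. a $ i * v $ i) = 0))"
    by (simp add: Int_def)
  also have "\<dots> = (\<Sum>v\<in>Z. \<Sum>a\<in>UNIV - {0}. of_bool ((\<Sum>i\<in>UNIV. a $ i * v $ i) = 0))"
    by (rule sum.swap)
  also have "\<dots> = (\<Sum>v\<in>Z. int (card {a \<in> UNIV - {0}. (\<Sum>i\<in>UNIV. a $ i * v $ i) = 0}))"
    by (simp add: Int_def)
  also have "\<dots> = (\<Sum>v\<in>Z. (int CARD('k))\<^sup>2 - 1)"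
    using nonzero by (intro sum.cong card_nonzero_orthogonal) auto
  finally show ?thesis
    by simp
qed

text \<open>The square counts pairs \<open>(u, v)\<close> on a common line. If \<open>v\<close> is
  one of the \<open>CARD('k) - 1\<close> multiples of \<open>u\<close>, there is a single linear
  condition on \<open>a\<close>; otherwise there are two independent ones.\<close>

lemma sum_incidences_squared:
  "(\<Sum>a\<in>UNIV - {0}. (int (card {v \<in> Z. (\<Sum>i\<in>UNIV. a $ i * v $ i) = 0}))\<^sup>2)
    = int (card Z) * ((int CARD('k) - 1) * ((int CARD('k))\<^sup>2 - 1)
      + (int (card Z) - (int CARD('k) - 1)) * (int CARD('k) - 1))"
proof -
  let ?q = "int CARD('k)"
  let ?I = "\<lambda>u v. {a \<in> UNIV - {0}. (\<Sum>i\<in>UNIV. a $ i * u $ i) = 0 \<and> (\<Sum>i\<in>UNIV. a $ i * v $ i) = 0}"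
  have row: "(\<Sum>v\<in>Z. int (card (?I u v))) = (?q - 1) * (?q\<^sup>2 - 1) + (int (card Z) - (?q - 1)) * (?q - 1)"
    if "u \<in> Z" for u
  proof -
    let ?L = "(\<lambda>c. c *s u) ` (UNIV - {0})"
    have u: "u \<noteq> 0"
      using that nonzero by auto
    have sub: "?L \<subseteq> Z"
      using that scale by auto
    have "card ?L = CARD('k) - 1"
      using u by (rule card_multiples)
    then have L: "int (card ?L) = ?q - 1"
      by (simp add: of_nat_diff Suc_le_eq)
    have "int (card (?I u v)) = ?q\<^sup>2 - 1" if v: "v \<in> ?L" for v
    proof -
      obtain c where "v = c *s u"
        using v by blast
      then have "?I u v = {a \<in> UNIV - {0}. (\<Sum>i\<in>UNIV. a $ i * u $ i) = 0}"
        by (auto simp: mult.left_commute simp flip: sum_distrib_left)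
      then show ?thesis
        using card_nonzero_orthogonal[OF u] by simp
    qed
    then have on: "(\<Sum>v\<in>?L. int (card (?I u v))) = (\<Sum>v\<in>?L. ?q\<^sup>2 - 1)"
      by (intro sum.cong refl)
    have "int (card (?I u v)) = ?q - 1" if v: "v \<in> Z - ?L" for v
    proof (intro card_nonzero_orthogonal2[OF u] notI)
      fix c assume c: "v = c *s u"
      then have "c \<noteq> 0"
        using v nonzero by auto
      then show False
        using v c by auto
    qed
    then have off: "(\<Sum>v\<in>Z - ?L. int (card (?I u v))) = (\<Sum>v\<in>Z - ?L. ?q - 1)"
      by (intro sum.cong refl)
    have "(\<Sum>v\<in>Z. int (card (?I u v))) = (\<Sum>v\<in>Z - ?L. ?q - 1) + (\<Sum>v\<in>?L. ?q\<^sup>2 - 1)"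
      unfolding on[symmetric] off[symmetric] by (rule sum.subset_diff[OF sub finite])
    also have "\<dots> = (int (card Z) - int (card ?L)) * (?q - 1) + int (card ?L) * (?q\<^sup>2 - 1)"
      using sub by (simp add: card_Diff_subset of_nat_diff card_mono)
    finally show ?thesis
      unfolding L by simp
  qed
  have "(int (card {v \<in> Z. (\<Sum>i\<in>UNIV. a $ i * v $ i) = 0}))\<^sup>2 =
     (\<Sum>u\<in>Z. \<Sum>v\<in>Z. of_bool ((\<Sum>i\<in>UNIV. a $ i * u $ i) = 0 \<and> (\<Sum>i\<in>UNIV. a $ i * v $ i) = 0))" for a
  proof -
    have "int (card {v \<in> Z. (\<Sum>i\<in>UNIV. a $ i * v $ i) = 0}) = (\<Sum>v\<in>Z. of_bool ((\<Sum>i\<in>UNIV. a $ i * v $ i) = 0))"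
      by (simp add: Int_def)
    then show ?thesis
      by (simp only: power2_eq_square sum_product of_bool_conj)
  qed
  then have "(\<Sum>a\<in>UNIV - {0}. (int (card {v \<in> Z. (\<Sum>i\<in>UNIV. a $ i * v $ i) = 0}))\<^sup>2) =
    (\<Sum>a\<in>UNIV - {0}. \<Sum>u\<in>Z. \<Sum>v\<in>Z. of_bool ((\<Sum>i\<in>UNIV. a $ i * u $ i) = 0 \<and> (\<Sum>i\<in>UNIV. a $ i * v $ i) = 0))"
    by simp
  also have "\<dots> = (\<Sum>u\<in>Z. \<Sum>v\<in>Z. \<Sum>a\<in>UNIV - {0}. of_bool ((\<Sum>i\<in>UNIV. a $ i * u $ i) = 0 \<and> (\<Sum>i\<in>UNIV. a $ i * v $ i) = 0))"
    by (subst sum.swap) (rule sum.cong[OF refl sum.swap])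
  also have "\<dots> = (\<Sum>u\<in>Z. \<Sum>v\<in>Z. int (card (?I u v)))"
    by (simp add: Int_def)
  also have "\<dots> = (\<Sum>u\<in>Z. (?q - 1) * (?q\<^sup>2 - 1) + (int (card Z) - (?q - 1)) * (?q - 1))"
    by (intro sum.cong row refl)
  finally show ?thesis
    by simp
qed

text \<open>If all counts lay between \<open>s\<close> and \<open>3 * s\<close>, with
  \<open>s = CARD('k) - 1\<close>, the sum of \<open>(n a - s) * (n a - 3 * s)\<close> would be at
  most 0. The two moments show that it is positive.\<close>

lemma ex_line_exceptional:
  assumes q: "5 \<le> CARD('k)"
  shows "\<exists>a. a \<noteq> 0 \<and> \<not> (CARD('k) - 1 \<le> card {v \<in> Z. (\<Sum>i\<in>UNIV. a $ i * v $ i) = 0}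
    \<and> card {v \<in> Z. (\<Sum>i\<in>UNIV. a $ i * v $ i) = 0} \<le> 3 * (CARD('k) - 1))"
proof (rule ccontr)
  assume neg: "\<not> ?thesis"
  define n where "n a = int (card {v \<in> Z. (\<Sum>i\<in>UNIV. a $ i * v $ i) = 0})" for a
  define q where "q = int CARD('k)"
  define s where "s = q - 1"
  define M where "M = int (card Z)"
  have q5: "5 \<le> q"
    using q by (simp add: q_def)
  have bounds: "s \<le> n a" "n a \<le> 3 * s" if "a \<noteq> 0" for a
    using neg that q by (fastforce simp: s_def q_def n_def)+
  have "card (UNIV - {0 :: 'k ^ 3}) = CARD('k) ^ 3 - 1"
    by (simp add: card_Diff_singleton CARD_vec)
  then have card_lines: "int (card (UNIV - {0 :: 'k ^ 3})) = q ^ 3 - 1"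
    by (simp add: q_def of_nat_diff Suc_le_eq)
  have "(\<Sum>a\<in>UNIV - {0}. (n a - s) * (n a - 3 * s)) \<le> 0"
    using bounds by (intro sum_nonpos mult_nonneg_nonpos) auto
  also have "(\<Sum>a\<in>UNIV - {0}. (n a - s) * (n a - 3 * s))
    = (\<Sum>a\<in>UNIV - {0}. (n a)\<^sup>2 - 4 * s * n a + 3 * s\<^sup>2)"
    by (intro sum.cong refl) (simp add: power2_eq_square algebra_simps)
  also have "\<dots> = (\<Sum>a\<in>UNIV - {0}. (n a)\<^sup>2) - 4 * s * (\<Sum>a\<in>UNIV - {0}. n a)
      + int (card (UNIV - {0 :: 'k ^ 3})) * (3 * s\<^sup>2)"
    by (simp add: sum.distrib sum_subtractf sum_distrib_left)
  also have "\<dots> = M * (s * (q\<^sup>2 - 1) + (M - s) * s) - 4 * s * (M * (q\<^sup>2 - 1)) + (q ^ 3 - 1) * (3 * s\<^sup>2)"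
    using sum_incidences sum_incidences_squared unfolding card_lines by (simp add: n_def M_def q_def s_def)
  also have "\<dots> = s * (M\<^sup>2 - s * (3 * q + 4) * M + 3 * s\<^sup>2 * (q\<^sup>2 + q + 1))"
    by (simp add: s_def power2_eq_square power3_eq_cube algebra_simps)
  finally have "M\<^sup>2 - s * (3 * q + 4) * M + 3 * s\<^sup>2 * (q\<^sup>2 + q + 1) \<le> 0" (is "?Q \<le> 0")
    using q5 by (simp add: s_def mult_le_0_iff)
  then have "4 * ?Q \<le> 0"
    by simp
  \<comment> \<open>Completing the square in \<open>M\<close>; the remaining term is minus the
    discriminant of the quadratic.\<close>
  also have "4 * ?Q = (2 * M - s * (3 * q + 4))\<^sup>2 + s\<^sup>2 * (3 * q * (q - 4) - 4)"
    by (simp add: power2_eq_square algebra_simps)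
  finally have "(2 * M - s * (3 * q + 4))\<^sup>2 + s\<^sup>2 * (3 * q * (q - 4) - 4) \<le> 0" .
  moreover have "0 < s\<^sup>2 * (3 * q * (q - 4) - 4)"
  proof (rule mult_pos_pos)
    \<comment> \<open>This is where \<open>5 \<le> q\<close> enters: for \<open>q = 4\<close> the
      factor \<open>q - 4\<close> vanishes and the term is negative.\<close>
    have "15 * 1 \<le> (3 * q) * (q - 4)"
      using q5 by (intro mult_mono) auto
    then show "0 < 3 * q * (q - 4) - 4"
      by simp
  qed (use q5 in \<open>simp add: s_def\<close>)
  then have "0 < (2 * M - s * (3 * q + 4))\<^sup>2 + s\<^sup>2 * (3 * q * (q - 4) - 4)"
    by (intro add_nonneg_pos zero_le_power2)
  ultimately show False
    by (meson leD)
qed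

end

section \<open>Application to the cone over an irreducible cubic\<close>

theorem theorem1p3:
  fixes q :: nat and F :: "'k::{field,finite} ternary_poly"
  assumes "primepow q" and "CARD('k) = q"
    and "plane_curve 3 F" and "irreducible F"
    and "q \<ge> 5"
  shows "\<not> blocking_curve F"
proof
  assume blocking: "blocking_curve F"
  have F: "homogeneous 3 F"
    using assms(3) by (simp add: plane_curve_def)
  define Z where "Z = {v. v \<noteq> 0 \<and> poly_eval F v = 0}"
  have scale: "c *s v \<in> Z" if "v \<in> Z" "c \<noteq> 0" for c v
    using that by (simp add: Z_def poly_eval_scale[OF F] vec_eq_iff)
  have line: "{v \<in> Z. (\<Sum>i\<in>UNIV. a $ i * v $ i) = 0} =
    {v. v \<noteq> 0 \<and> poly_eval F v = 0 \<and> (\<Sum>i\<in>UNIV. a $ i * v $ i) = 0}" for a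
    by (auto simp: Z_def)
  have lower: "CARD('k) - 1 \<le> card {v \<in> Z. (\<Sum>i\<in>UNIV. a $ i * v $ i) = 0}" if "a \<noteq> 0" for a
  proof -
    have "line_points a \<inter> curve_points F \<noteq> {}"
      using blocking that by (simp add: blocking_curve_def blocking_set_def)
    then obtain u v where u: "u \<noteq> 0" "(\<Sum>i\<in>UNIV. a $ i * u $ i) = 0" and v: "v \<in> Z"
      and uv: "proj_point u = proj_point v"
      by (auto simp: line_points_def curve_points_def Z_def)
    have "u \<in> proj_point u"
      using u by (auto simp: proj_point_def proj_rel_def intro!: exI[of _ 1])
    \<comment> \<open>The vectors witnessing the line and the curve represent the same point but may
      differ by a scalar, under which \<open>Z\<close> is closed.\<close>
    then obtain c where "c \<noteq> 0" "u = c *s v"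
      unfolding uv by (auto simp: proj_point_def proj_rel_def)
    then have "u \<in> Z"
      using v scale by simp
    \<comment> \<open>One common point contributes all of its nonzero representatives, which gives
      the lower bound \<open>CARD('k) - 1\<close>.\<close>
    then have "(\<lambda>c. c *s u) ` (UNIV - {0}) \<subseteq> {v \<in> Z. (\<Sum>i\<in>UNIV. a $ i * v $ i) = 0}"
      using u(2) scale by (auto simp: mult.left_commute simp flip: sum_distrib_left)
    then have "card ((\<lambda>c. c *s u) ` (UNIV - {0})) \<le> card {v \<in> Z. (\<Sum>i\<in>UNIV. a $ i * v $ i) = 0}"
      by (intro card_mono) auto
    then show ?thesis
      using card_multiples[OF u(1)] by simp
  qed
  have upper: "card {v \<in> Z. (\<Sum>i\<in>UNIV. a $ i * v $ i) = 0} \<le> 3 * (CARD('k) - 1)" if "a \<noteq> 0" for a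
    unfolding line using F assms(4) _ that by (rule card_zeros_on_line) simp
  have "0 \<notin> Z" "5 \<le> CARD('k)"
    using assms(2,5) by (simp_all add: Z_def)
  then obtain a where "a \<noteq> 0" "\<not> (CARD('k) - 1 \<le> card {v \<in> Z. (\<Sum>i\<in>UNIV. a $ i * v $ i) = 0}
      \<and> card {v \<in> Z. (\<Sum>i\<in>UNIV. a $ i * v $ i) = 0} \<le> 3 * (CARD('k) - 1))"
    using ex_line_exceptional[of Z] scale by blast
  then show False
    using lower upper by simp
qed

end
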